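(* Let $a, b$ be relatively prime positive integers such that $\frac{5}{3} \leq \frac{a}{b} < 2$ and $\gcd(b,2) = 1$. Let $\varphi$ be the $(2a-b)$-uniform morphism on $\mathbb{Z}_{\geq 0}$ defined by $\varphi(n) = 0^{a - 1} \, 1 \, 0^{a - b - 1} \, (n + 1)$ for all $n \in \mathbb{Z}_{\geq 0}$. Then $\textbf{w}_{a/b} = \varphi^\infty(0)$. In particular, $\rho(\frac{a}{b}) = 2a-b$.
   Context: Words are indexed from position $0$; a factor is a contiguous subword; $c^m$ denotes $m$ copies of the letter $c$. For relatively prime positive integers $a,b$ and a nonempty word $v$ whose length is divisible by $b$, define $v^{a/b} = v^{\lfloor a/b \rfloor} v_0 v_1 \cdots v_{t-1}$, where $t = |v|\,(a/b - \lfloor a/b\rfloor)$; such a word is called an $\frac{a}{b}$-power. A word is $\frac{a}{b}$-power-free if none of its factors is an $\frac{a}{b}$-power. For $\frac{a}{b} > 1$, $\textbf{w}_{a/b}$ denotes the lexicographically least infinite word over $\mathbb{Z}_{\geq 0}$ that is $\frac{a}{b}$-power-free. A morphism $\varphi$ on $\Sigma$ is a map $\Sigma \to \Sigma^*$ extended by concatenation; it is $k$-uniform if all images have length $k$; if $\varphi(c)$ begins with $c$, $\varphi^\infty(c)$ is the infinite fixed point beginning with $c$. For $k \geq 2$, an integer sequence $s(i)_{i\ge0}$ is $k$-regular if the $\mathbb{Z}$-module generated by $\{ s(k^e i + j)_{i \geq 0} : e \geq 0,\ 0 \leq j \leq k^e - 1 \}$ is finitely generated. Integers $k,l\ge 2$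 are multiplicatively dependent ($k\sim l$) if $k^s=l^t$ for some positive integers $s,t$. When nonempty, the set of $k\ge2$ for which the letter sequence of $\textbf{w}_{a/b}$ is $k$-regular is a single $\sim$-class, denoted $\rho(\frac{a}{b})$; writing $\rho(\frac{a}{b}) = k$ means $k$ belongs to this class. *)

theory Defs
  imports
    Complex_Main
    "HOL-Library.Omega_Words_Fun"
    "HOL-Library.Fun_Lexorder"
    "HOL-Library.Function_Algebras"
begin

section \<open>Fractional powers\<close>

text \<open>
  Finite words are lists and infinite words are functions \<^typ>\<open>nat \<Rightarrow> 'a\<close>. In \<open>v\<^bsup>a/b\<^esup>\<close> the integer
  part of \<open>a/b\<close> is \<open>a div b\<close> and \<open>a/b - \<lfloor>a/b\<rfloor> = (a mod b) / b\<close>, so that the number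
  \<open>t = |v| (a/b - \<lfloor>a/b\<rfloor>)\<close> is the natural number \<open>|v| (a mod b) div b\<close>; see \<open>frac_part_length\<close>.
\<close>

definition frac_power :: "nat \<Rightarrow> nat \<Rightarrow> 'a list \<Rightarrow> 'a list" where
  "frac_power a b v = concat (replicate (a div b) v) @ take (length v * (a mod b) div b) v"

lemma frac_part_length:
  assumes "b > 0" "b dvd n"
  shows "real (n * (a mod b) div b) = real n * (real a / real b - of_int \<lfloor>real a / real b\<rfloor>)"
proof -
  have "real a / real b - of_int \<lfloor>real a / real b\<rfloor> = real (a mod b) / real b"
  proof -
    have "real a = real (a div b) * real b + real (a mod b)"
      by (metis div_mult_mod_eq of_nat_add of_nat_mult)
    then have "real a / real b = real (a div b) + real (a mod b) / real b"
      using assms(1) by (simp add: field_simps)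
    then show ?thesis
      by (simp add: floor_divide_of_nat_eq)
  qed
  moreover have "b dvd n * (a mod b)"
    using assms(2) by simp
  ultimately show ?thesis
    by (simp add: real_of_nat_div)
qed

definition is_frac_power :: "nat \<Rightarrow> nat \<Rightarrow> 'a list \<Rightarrow> bool" where
  "is_frac_power a b u \<longleftrightarrow> (\<exists>v. v \<noteq> [] \<and> b dvd length v \<and> u = frac_power a b v)"

definition frac_power_free :: "nat \<Rightarrow> nat \<Rightarrow> (nat \<Rightarrow> 'a) \<Rightarrow> bool" where
  "frac_power_free a b x \<longleftrightarrow> (\<forall>i j. i \<le> j \<longrightarrow> \<not> is_frac_power a b (subsequence x i j))"


section \<open>The lexicographically least power-free word\<close>

definition lex_least_free :: "nat \<Rightarrow> nat \<Rightarrow> (nat \<Rightarrow> nat) \<Rightarrow> bool" where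
  "lex_least_free a b x \<longleftrightarrow>
     frac_power_free a b x \<and> (\<forall>y. frac_power_free a b y \<longrightarrow> x = y \<or> less_fun x y)"

text \<open>The description is proper for \<open>a/b > 1\<close>; see \<open>ex1_lex_least_free\<close>.\<close>

definition least_free_word :: "nat \<Rightarrow> nat \<Rightarrow> nat \<Rightarrow> nat" where
  "least_free_word a b = (THE x. lex_least_free a b x)"

lemma frac_power_free_ident:
  assumes "0 < b" "b < a"
  shows "frac_power_free a b (\<lambda>n. n :: nat)"
proof -
  have "\<not> is_frac_power a b (subsequence (\<lambda>n. n) i j)" for i j
  proof
    assume "is_frac_power a b (subsequence (\<lambda>n. n) i j)"
    then obtain v where v: "v \<noteq> []" "b dvd length v"
      and eq: "[i..<j] = frac_power a b v"
      by (auto simp: is_frac_power_def subsequence_def)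
    have "distinct (frac_power a b v)"
      by (metis eq distinct_upt)
    then have dist: "distinct (concat (replicate (a div b) v) @ take (length v * (a mod b) div b) v)"
      by (simp add: frac_power_def)
    have "1 \<le> a div b"
      using assms by (simp add: Suc_leI div_greater_zero_iff)
    then obtain q where q: "a div b = Suc q"
      by (cases "a div b") auto
    show False
    proof (cases q)
      case 0
      have "a mod b \<noteq> 0"
        using q 0 assms by (metis One_nat_def add.right_neutral div_mult_mod_eq nat_mult_1 less_irrefl)
      moreover have "b \<le> length v"
        using v by (simp add: dvd_imp_le)
      ultimately have "b \<le> length v * (a mod b)"
        by (metis Suc_leI gr0I le_trans mult.right_neutral mult_le_mono2 One_nat_def)
      then have "0 < length v * (a mod b) div b"
        using assms by (simp add: div_greater_zero_iff)
      then have "hd v \<in> set (take (length v * (a mod b) div b) v)"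
        using v(1) by (cases v; cases "length v * (a mod b) div b") auto
      then show False
        using dist q 0 v(1) by (auto dest: in_set_takeD)
    next
      case (Suc r)
      then show False
        using dist q v(1) by auto
    qed
  qed
  then show ?thesis
    by (simp add: frac_power_free_def)
qed

lemma ex1_lex_least_free:
  assumes "0 < b" "b < a"
  shows "\<exists>!x. lex_least_free a b x"
proof -
  let ?F = "\<lambda>y :: nat \<Rightarrow> nat. frac_power_free a b y"
  define next_letter where
    "next_letter p = (LEAST c. \<exists>y. ?F y \<and> subsequence y 0 (length p) = p \<and> y (length p) = c)" for p
  define P where "P = rec_nat [] (\<lambda>_ p. p @ [next_letter p])"
  have P0: "P 0 = []" and PS: "P (Suc n) = P n @ [next_letter (P n)]" for n
    by (simp_all add: P_def)
  have lenP: "length (P n) = n" for n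
    by (induction n) (simp_all add: P0 PS)
  have ext: "\<exists>y. ?F y \<and> subsequence y 0 n = P n" for n
  proof (induction n)
    case 0
    show ?case
      using frac_power_free_ident[OF assms] by (auto simp: P0 subsequence_def)
  next
    case (Suc n)
    then obtain z where "?F z" "subsequence z 0 n = P n" by blast
    then have "\<exists>c y. ?F y \<and> subsequence y 0 (length (P n)) = P n \<and> y (length (P n)) = c"
      by (auto simp: lenP)
    from LeastI_ex[OF this, folded next_letter_def]
    obtain y where "?F y" "subsequence y 0 n = P n" "y n = next_letter (P n)"
      by (auto simp: lenP)
    then show ?case
      by (intro exI[of _ y]) (simp add: PS subsequence_def)
  qed
  define x where "x n = next_letter (P n)" for n
  have prefx: "subsequence x 0 n = P n" for n
    by (induction n) (simp_all add: P0 PS x_def subsequence_def)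
  have "?F x"
    unfolding frac_power_free_def
  proof (intro allI impI)
    fix i j :: nat assume "i \<le> j"
    obtain y where y: "?F y" "subsequence y 0 j = P j"
      using ext by blast
    then have "map y [0..<j] = map x [0..<j]"
      using prefx[of j] by (simp add: subsequence_def)
    then have "\<forall>m<j. y m = x m"
      by (simp only: map_eq_conv) simp
    then have "subsequence x i j = subsequence y i j"
      by (auto simp: subsequence_def)
    then show "\<not> is_frac_power a b (subsequence x i j)"
      using y(1) \<open>i \<le> j\<close> by (simp add: frac_power_free_def)
  qed
  moreover have "x = y \<or> less_fun x y" if "?F y" for y
  proof (cases "x = y")
    case False
    then have ex: "\<exists>n. x n \<noteq> y n" by auto
    define k where "k = (LEAST n. x n \<noteq> y n)"
    have k: "x k \<noteq> y k"
      unfolding k_def using ex by (rule LeastI_ex)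
    have lt: "x m = y m" if "m < k" for m
      using that not_less_Least unfolding k_def by blast
    then have "subsequence y 0 k = subsequence x 0 k"
      by (simp add: subsequence_def)
    then have "subsequence y 0 k = P k"
      using prefx[of k] by simp
    then have "x k \<le> y k"
      unfolding x_def next_letter_def by (intro Least_le) (use that in \<open>auto simp: lenP\<close>)
    then show ?thesis
      using k lt unfolding less_fun_def by (metis order_less_le)
  qed simp
  ultimately have "lex_least_free a b x"
    by (simp add: lex_least_free_def)
  then show ?thesis
    unfolding lex_least_free_def by (metis less_fun_asym)
qed


section \<open>Morphisms and their fixed points\<close>

definition uniform_morphism :: "nat \<Rightarrow> ('a \<Rightarrow> 'a list) \<Rightarrow> bool" where
  "uniform_morphism k \<phi> \<longleftrightarrow> (\<forall>c. length (\<phi> c) = k)"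

definition apply_morphism :: "('a \<Rightarrow> 'a list) \<Rightarrow> 'a list \<Rightarrow> 'a list" where
  "apply_morphism \<phi> u = concat (map \<phi> u)"

text \<open>
  The equation \<open>\<phi>(x) = x\<close> for an infinite word \<open>x\<close> is stated through prefixes: the image of every
  prefix of \<open>x\<close> is a prefix of \<open>x\<close>.
\<close>

definition fixed_by :: "('a \<Rightarrow> 'a list) \<Rightarrow> (nat \<Rightarrow> 'a) \<Rightarrow> bool" where
  "fixed_by \<phi> x \<longleftrightarrow>
     (\<forall>n. apply_morphism \<phi> (prefix n x) = prefix (length (apply_morphism \<phi> (prefix n x))) x)"

definition fixed_point :: "('a \<Rightarrow> 'a list) \<Rightarrow> 'a \<Rightarrow> nat \<Rightarrow> 'a" where
  "fixed_point \<phi> c = (THE x. x 0 = c \<and> fixed_by \<phi> x)"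

lemma length_apply_uniform:
  "uniform_morphism k \<phi> \<Longrightarrow> length (apply_morphism \<phi> u) = k * length u"
  by (induction u) (auto simp: apply_morphism_def uniform_morphism_def)

lemma ex1_fixed_point:
  assumes unif: "uniform_morphism k \<phi>" and "2 \<le> k" and "hd (\<phi> c) = c"
  shows "\<exists>!x. x 0 = c \<and> fixed_by \<phi> x"
proof -
  define x where
    "x = wfrec less_than (\<lambda>x n. if n = 0 then c else \<phi> (x (n div k)) ! (n mod k))"
  have x: "x n = (if n = 0 then c else \<phi> (x (n div k)) ! (n mod k))" for n
    unfolding x_def using \<open>2 \<le> k\<close> by (subst wfrec) (auto simp: cut_def)
  have len: "length (\<phi> d) = k" for d
    using unif by (simp add: uniform_morphism_def)
  have xk: "x (k * n + j) = \<phi> (x n) ! j" if "j < k" for n j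
  proof (cases "k * n + j = 0")
    case True
    then have "n = 0" "j = 0"
      using \<open>2 \<le> k\<close> by auto
    moreover have "\<phi> c ! 0 = c"
      using len[of c] \<open>2 \<le> k\<close> assms(3) by (metis hd_conv_nth list.size(3) not_numeral_le_zero)
    ultimately show ?thesis
      by (simp add: x[of 0])
  next
    case False
    then show ?thesis
      using that \<open>2 \<le> k\<close> by (subst x) (simp only: if_False, simp)
  qed
  have block: "\<phi> (x n) = map x [k * n..<k * n + k]" for n
    by (rule nth_equalityI) (simp_all add: len xk)
  have "apply_morphism \<phi> (prefix n x) = prefix (k * n) x" for n
  proof (induction n)
    case (Suc n)
    then show ?case
      by (simp add: apply_morphism_def subsequence_def block add.commute[of k]
          upt_add_eq_append[of 0 "k * n" k, simplified])
  qed (simp add: apply_morphism_def subsequence_def)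
  then have "fixed_by \<phi> x"
    by (simp add: fixed_by_def)
  moreover have "x 0 = c"
    by (simp add: x[of 0])
  moreover have "y = z"
    if y: "y 0 = c" "fixed_by \<phi> y" and z: "z 0 = c" "fixed_by \<phi> z" for y z
  proof
    fix n
    show "y n = z n"
    proof (induction n rule: less_induct)
      case (less n)
      show ?case
      proof (cases "n = 0")
        case False
        let ?q = "Suc (n div k)"
        have q: "n div k < n" "n < k * ?q"
          using False \<open>2 \<le> k\<close> by (simp_all add: dividend_less_times_div)
        have nth: "u n = apply_morphism \<phi> (prefix ?q u) ! n" if "fixed_by \<phi> u" for u
        proof -
          have "apply_morphism \<phi> (prefix ?q u) = prefix (k * ?q) u"
            using that length_apply_uniform[OF unif, of "prefix ?q u"]
            unfolding fixed_by_def by (metis subsequence_length diff_zero)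
          then show ?thesis
            using q(2) by (simp add: subsequence_def del: upt_Suc mult_Suc_right)
        qed
        have "prefix ?q y = prefix ?q z"
          using less q(1) by (simp add: subsequence_def)
        then show ?thesis
          using nth[OF y(2)] nth[OF z(2)] by simp
      qed (simp add: y z)
    qed
  qed
  ultimately show ?thesis
    by blast
qed


section \<open>Regular sequences\<close>

definition int_scale :: "int \<Rightarrow> (nat \<Rightarrow> int) \<Rightarrow> nat \<Rightarrow> int" where
  "int_scale m s = (\<lambda>i. m * s i)"

interpretation int_seq: module int_scale
  by standard (auto simp: int_scale_def fun_eq_iff algebra_simps)

definition kernel :: "nat \<Rightarrow> (nat \<Rightarrow> int) \<Rightarrow> (nat \<Rightarrow> int) set" where
  "kernel k s = {(\<lambda>i. s (k ^ e * i + j)) | e j. j \<le> k ^ e - 1}"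

definition regular :: "nat \<Rightarrow> (nat \<Rightarrow> int) \<Rightarrow> bool" where
  "regular k s \<longleftrightarrow> (\<exists>B. finite B \<and> int_seq.span B = int_seq.span (kernel k s))"

text \<open>
  When nonempty, this set is a single class of multiplicatively dependent integers, and
  \<open>\<rho>(a/b) = k\<close> is the usual way to write that \<open>k\<close> is one of its elements.
\<close>

definition rho :: "nat \<Rightarrow> nat \<Rightarrow> nat set" where
  "rho a b = {k. 2 \<le> k \<and> regular k (\<lambda>i. int (least_free_word a b i))}"

end

theory Submission
  imports Defs
begin

text \<open>
  Write \<open>c = a - b\<close> and \<open>k = 2a - b\<close>. An \<open>a/b\<close>-power is a stretch of \<open>mc\<close> letters that repeats at
  distance \<open>mb\<close>. If \<open>k\<close> divides \<open>m\<close>, reading only the last letters of the blocks yields a power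
  with \<open>m/k\<close> in place of \<open>m\<close>. Otherwise \<open>mb\<close> is not divisible by \<open>k\<close>, and already the positions of
  the nonzero letters, which are periodic modulo \<open>k\<close>, do not fit: \<open>m = 1\<close>, \<open>m = 2\<close> and \<open>m \<ge> 3\<close> are
  treated separately. Conversely, decreasing a letter of the fixed point creates a power ending
  there: \<open>0\<^sup>a\<close> or \<open>0\<^bsup>b-1\<^esup> 1 0\<^bsup>c\<^esup>\<close> if the new letter is \<open>0\<close>, and otherwise the image under \<open>\<phi>\<close> of a power
  obtained by decreasing an earlier letter.
\<close>

section \<open>Fractional powers with exponent below 2\<close>

definition repeats :: "nat \<Rightarrow> nat \<Rightarrow> (nat \<Rightarrow> 'a) \<Rightarrow> nat \<Rightarrow> bool" where
  "repeats p l x i \<longleftrightarrow> (\<forall>j<l. x (i + j) = x (i + j + p))"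

text \<open>As \<open>c < b\<close>, the exponent has integer part 1, so a power with
  \<open>length v = m * b\<close> is \<open>v\<close> followed by its own prefix of length
  \<open>m * c\<close>.\<close>

lemma is_frac_power_subsequence_iff:
  assumes "c < b"
  shows "is_frac_power (b + c) b (subsequence x i j) \<longleftrightarrow>
    (\<exists>m>0. j - i = m * (b + c) \<and> repeats (m * b) (m * c) x i)"
proof -
  have div_mod: "(b + c) div b = 1" "(b + c) mod b = c"
    using assms by (simp_all add: div_add_self1)
  have power: "frac_power (b + c) b v = v @ take (m * c) v" if "length v = m * b" for m and v :: "'a list"
    using that assms div_mod by (simp add: frac_power_def mult.assoc mult.left_commute[of m])
  show ?thesis
  proof
    assume "is_frac_power (b + c) b (subsequence x i j)"
    then obtain v where v: "v \<noteq> []" "b dvd length v" "subsequence x i j = frac_power (b + c) b v"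
      by (auto simp: is_frac_power_def)
    then obtain m where m: "length v = m * b"
      by (metis dvd_def mult.commute)
    have "m > 0"
      using m v(1) by (cases m) auto
    have eq: "subsequence x i j = v @ take (m * c) v"
      using v(3) power[OF m] by simp
    have len: "j - i = m * (b + c)"
      using arg_cong[OF eq, of length] m assms
      by (simp add: subsequence_def distrib_left min_absorb2)
    have "repeats (m * b) (m * c) x i"
      unfolding repeats_def
    proof (intro allI impI)
      fix l assume "l < m * c"
      then have "l < m * b"
        using assms by (meson less_imp_le_nat mult_le_mono2 order_less_le_trans)
      have "x (i + l) = subsequence x i j ! l"
        using len \<open>l < m * b\<close> by (simp add: subsequence_def distrib_left)
      also have "\<dots> = subsequence x i j ! (m * b + l)"
        unfolding eq using m \<open>l < m * b\<close> \<open>l < m * c\<close> by (simp add: nth_append)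
      also have "\<dots> = x (i + l + m * b)"
        using len \<open>l < m * c\<close> by (simp add: subsequence_def distrib_left ac_simps)
      finally show "x (i + l) = x (i + l + m * b)" .
    qed
    then show "\<exists>m>0. j - i = m * (b + c) \<and> repeats (m * b) (m * c) x i"
      using \<open>m > 0\<close> len by blast
  next
    assume "\<exists>m>0. j - i = m * (b + c) \<and> repeats (m * b) (m * c) x i"
    then obtain m where m: "m > 0" "j - i = m * (b + c)" "repeats (m * b) (m * c) x i"
      by blast
    let ?v = "map x [i..<i + m * b]"
    have "m * c \<le> m * b"
      using assms by simp
    have "subsequence x i j = ?v @ take (m * c) ?v"
    proof (rule nth_equalityI)
      show "length (subsequence x i j) = length (?v @ take (m * c) ?v)"
        using m(2) assms by (simp add: subsequence_def distrib_left min_absorb2)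
      fix l assume "l < length (subsequence x i j)"
      then have l: "l < m * b + m * c"
        using m(2) by (simp add: subsequence_def distrib_left)
      then have "subsequence x i j ! l = x (i + l)"
        using m(2) by (simp add: subsequence_def distrib_left)
      also have "\<dots> = (?v @ take (m * c) ?v) ! l"
      proof (cases "l < m * b")
        case True
        then show ?thesis
          by (simp add: nth_append)
      next
        case False
        define l' where "l' = l - m * b"
        have l': "l = m * b + l'" "l' < m * c" "l' < m * b"
          using False l \<open>m * c \<le> m * b\<close> unfolding l'_def by linarith+
        have "x (i + l) = x (i + l')"
          using m(3) l' unfolding repeats_def by (metis add.assoc add.commute)
        then show ?thesis
          using l' by (simp add: nth_append)
      qed
      finally show "subsequence x i j ! l = (?v @ take (m * c) ?v) ! l" .
    qed
    then have "subsequence x i j = frac_power (b + c) b ?v"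
      by (simp add: power[of ?v m])
    moreover have "?v \<noteq> []"
      using m(1) assms by simp
    ultimately show "is_frac_power (b + c) b (subsequence x i j)"
      unfolding is_frac_power_def by (intro exI[of _ ?v]) simp
  qed
qed

lemma frac_power_free_iff:
  assumes "c < b"
  shows "frac_power_free (b + c) b x \<longleftrightarrow> (\<forall>m>0. \<forall>i. \<not> repeats (m * b) (m * c) x i)"
  unfolding frac_power_free_def is_frac_power_subsequence_iff[OF assms]
  by (metis diff_add_inverse le_add1)


section \<open>The fixed point\<close>

text \<open>The images of the prefixes of lengths \<open>n\<close> and \<open>Suc n\<close> are both
  prefixes of \<open>x\<close>, and they differ by exactly one image block.\<close>

lemma fixed_by_block:
  assumes "uniform_morphism k \<phi>" "fixed_by \<phi> x"
  shows "\<phi> (x n) = map x [k * n..<k * n + k]"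
proof -
  have pre: "apply_morphism \<phi> (prefix n x) = prefix (k * n) x" for n
    using assms(2) length_apply_uniform[OF assms(1), of "prefix n x"]
    unfolding fixed_by_def by (metis subsequence_length diff_zero)
  have "prefix (k * n) x @ \<phi> (x n) = apply_morphism \<phi> (prefix (Suc n) x)"
    unfolding pre[symmetric] by (simp add: apply_morphism_def subsequence_def)
  also have "\<dots> = prefix (k * n) x @ map x [k * n..<k * n + k]"
    unfolding pre by (simp add: subsequence_def add.commute[of k]
        upt_add_eq_append[of 0 "k * n" k, simplified])
  finally show ?thesis
    by simp
qed

text \<open>With \<open>a = b + c\<close>, \<open>b_le\<close> says that \<open>a / b\<close> is at
  least 5/3, and \<open>coprime_width\<close> combines coprimality of \<open>a\<close> and
  \<open>b\<close> with oddness of \<open>b\<close>.\<close>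

locale block_word =
  fixes b c :: nat and x :: "nat \<Rightarrow> nat"
  assumes c_less: "c < b" and b_le: "2 * b \<le> 3 * c" and coprime_width: "coprime (b + 2 * c) b"
    and x_blocks: "\<And>q r. r < b + 2 * c \<Longrightarrow> x ((b + 2 * c) * q + r) =
      (if r = b + c - 1 then 1 else if r = b + 2 * c - 1 then x q + 1 else 0)"
begin

definition k :: nat where
  k_eq: "k = b + 2 * c"

lemmas coprime = coprime_width[folded k_eq] and x_block = x_blocks[folded k_eq]

lemma c_pos: "0 < c" and k_pos: "0 < k"
  using c_less b_le by (simp_all add: k_eq)

section \<open>Positions of the nonzero letters\<close>

definition nonzero_pos :: "nat \<Rightarrow> bool" where
  "nonzero_pos n \<longleftrightarrow> n mod k = b + c - 1 \<or> n mod k = k - 1"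

lemma nonzero_iff: "x n \<noteq> 0 \<longleftrightarrow> nonzero_pos n"
  using x_block[of "n mod k" "n div k"] k_pos by (simp add: nonzero_pos_def)

text \<open>An explicit list turns the shift lemmas below into linear arithmetic;
  \<open>n + 1\<close> avoids truncated subtraction.\<close>

lemma nonzero_pos_iff:
  assumes "n < 3 * k"
  shows "nonzero_pos n \<longleftrightarrow> n + 1 \<in> {b + c, k, k + b + c, 2 * k, 2 * k + b + c, 3 * k}"
proof -
  obtain t where t: "t < k" "nonzero_pos n \<longleftrightarrow> t + 1 = b + c \<or> t + 1 = k"
    and n: "n = t \<or> n = k + t \<or> n = 2 * k + t"
  proof
    show "n mod k < k"
      using k_pos by simp
    show "nonzero_pos n \<longleftrightarrow> n mod k + 1 = b + c \<or> n mod k + 1 = k"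
      using c_pos k_pos unfolding nonzero_pos_def by linarith
    have "n div k < 3"
      using assms by (simp add: less_mult_imp_div_less)
    then consider "n div k = 0" | "n div k = 1" | "n div k = 2"
      by linarith
    then show "n = n mod k \<or> n = k + n mod k \<or> n = 2 * k + n mod k"
      using mult_div_mod_eq[of k n] by cases (simp_all add: mult.commute)
  qed
  from n show ?thesis
    unfolding t(2) using t(1) c_pos k_eq by (elim disjE) auto
qed

text \<open>For \<open>r < b\<close> the witness is a zero that is shifted onto a nonzero letter of
  the same block; from \<open>b\<close> on it is a nonzero letter that is shifted onto a
  zero.\<close>

lemma nonzero_shift1:
  assumes "r < k"
  shows "\<exists>j<c. nonzero_pos (r + j) \<noteq> nonzero_pos (r + j + b)"
proof -
  note bounds = assms c_less b_le k_eq c_pos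
  consider "r < c" | "c \<le> r" "r < b" | "b \<le> r" "r < b + c" | "b + c \<le> r"
    by linarith
  then show ?thesis
  proof cases
    case 1
    then show ?thesis
      using bounds by (intro exI[of _ "c - 1 - r"]) (auto simp: nonzero_pos_iff)
  next
    case 2
    then show ?thesis
      using bounds by (intro exI[of _ "2 * c - 1 - r"]) (auto simp: nonzero_pos_iff)
  next
    case 3
    then show ?thesis
      using bounds by (intro exI[of _ "b + c - 1 - r"]) (auto simp: nonzero_pos_iff)
  next
    case 4
    then show ?thesis
      using bounds by (intro exI[of _ "k - 1 - r"]) (auto simp: nonzero_pos_iff)
  qed
qed

lemma nonzero_shift2:
  assumes "r < k"
  shows "\<exists>j<2 * c. nonzero_pos (r + j) \<noteq> nonzero_pos (r + j + 2 * b)"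
proof -
  note bounds = assms c_less b_le k_eq c_pos
  consider "r < b - c" | "b - c \<le> r" "r < b + c" | "b + c \<le> r"
    by linarith
  then show ?thesis
  proof cases
    case 1
    \<comment> \<open>Position \<open>2 * c - 1 - b\<close> is a zero shifted onto
      \<open>k - 1\<close>. It does not precede \<open>r\<close> because
      \<open>2 * b \<le> 3 * c\<close>; here the bound 5/3 is used in full.\<close>
    then show ?thesis
      using bounds by (intro exI[of _ "2 * c - 1 - r - b"]) (auto simp: nonzero_pos_iff)
  next
    case 2
    then show ?thesis
      using bounds by (intro exI[of _ "b + c - 1 - r"]) (auto simp: nonzero_pos_iff)
  next
    case 3
    then show ?thesis
      using bounds by (intro exI[of _ "k - 1 - r"]) (auto simp: nonzero_pos_iff)
  qed
qed

text \<open>Modulo \<open>k\<close>, the nonzero residues \<open>b + c - 1\<close> and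
  \<open>k - 1\<close> lie \<open>c\<close> apart one way and \<open>b + c\<close> the other. So the
  first moves onto a zero under every shift but \<open>c\<close>, and the second under every shift
  but \<open>b + c\<close>; these two shifts get other witnesses.\<close>

lemma nonzero_shift3:
  assumes "r < k" "0 < p" "p < k"
  shows "\<exists>j<3 * c. nonzero_pos (r + j) \<noteq> nonzero_pos (r + j + p)"
proof -
  note bounds = assms c_less b_le k_eq c_pos
  consider "r < b + c" "p \<noteq> c" | "r < b - c" "p = c" | "b - c \<le> r" "r < b + c" "p = c"
    | "b + c \<le> r" "p \<noteq> b + c" | "b + c \<le> r" "p = b + c"
    by linarith
  then show ?thesis
  proof cases
    case 1
    then show ?thesis
      using bounds by (intro exI[of _ "b + c - 1 - r"]) (auto simp: nonzero_pos_iff)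
  next
    case 2
    then show ?thesis
      using bounds by (intro exI[of _ "b - 1 - r"]) (auto simp: nonzero_pos_iff)
  next
    case 3
    then show ?thesis
      using bounds by (intro exI[of _ "k - 1 - r"]) (auto simp: nonzero_pos_iff)
  next
    case 4
    then show ?thesis
      using bounds by (intro exI[of _ "k - 1 - r"]) (auto simp: nonzero_pos_iff)
  next
    case 5
    then show ?thesis
      using bounds by (intro exI[of _ "k + c - 1 - r"]) (auto simp: nonzero_pos_iff)
  qed
qed

section \<open>Power-freeness\<close>

lemma x_last: "x (k * q + (k - 1)) = x q + 1"
proof -
  have "k - 1 \<noteq> b + c - 1" "k - 1 < k"
    using c_pos k_eq by simp_all
  then show ?thesis
    by (simp only: x_block if_False if_True refl)
qed

lemma not_repeats:
  assumes "m > 0"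
  shows "\<not> repeats (m * b) (m * c) x i"
  using assms
proof (induction m arbitrary: i rule: less_induct)
  case (less m)
  show ?case
  proof
    assume rep: "repeats (m * b) (m * c) x i"
    show False
    proof (cases "k dvd m")
      case True
      then obtain m' where m': "m = k * m'" ..
      have "m' > 0" "m' < m"
        using m' less.prems c_less c_pos k_eq by auto
      have "repeats (m' * b) (m' * c) x (i div k)"
        unfolding repeats_def
      proof (intro allI impI)
        fix j assume "j < m' * c"
        \<comment> \<open>Chosen so that \<open>i + l\<close> is the last position of block
          \<open>i div k + j\<close>. The block containing \<open>i\<close> counts too, since its
          last position is not before \<open>i\<close>.\<close>
        define l where "l = k * j + (k - 1 - i mod k)"
        have l: "i + l = k * (i div k + j) + (k - 1)"
        proof -
          have "i mod k \<le> k - 1"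
            using k_pos by (metis One_nat_def Suc_pred less_Suc_eq_le mod_less_divisor)
          then show ?thesis
            unfolding l_def distrib_left using mult_div_mod_eq[of k i] by linarith
        qed
        have "l < k * (j + 1)"
          using k_pos by (simp add: l_def)
        also have "\<dots> \<le> m * c"
          using \<open>j < m' * c\<close> by (simp add: m' mult.assoc del: mult_Suc_right)
        finally have "x (i + l) = x (i + l + m * b)"
          using rep by (simp add: repeats_def)
        also have "i + l + m * b = k * (i div k + j + m' * b) + (k - 1)"
          by (simp add: l m' algebra_simps)
        finally show "x (i div k + j) = x (i div k + j + m' * b)"
          unfolding l x_last by simp
      qed
      then show False
        using less.IH[OF \<open>m' < m\<close> \<open>m' > 0\<close>] by blast
    next
      case False
      let ?r = "i mod k"
      have r: "?r < k"
        using k_pos by simp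
      \<comment> \<open>Only residues matter, so \<open>p\<close> may be any representative of
        \<open>m * b\<close> modulo \<open>k\<close>, in the form that the respective shift lemma
        expects.\<close>
      have nz: "nonzero_pos (?r + j) = nonzero_pos (?r + j + p)"
        if "j < m * c" "p mod k = m * b mod k" for j p
      proof -
        have "nonzero_pos (i + j) = nonzero_pos (i + j + m * b)"
          using rep that(1) unfolding repeats_def by (metis nonzero_iff)
        moreover have "(i + j) mod k = (?r + j) mod k"
          by (simp add: mod_simps)
        moreover have "(i + j + m * b) mod k = (?r + j + p) mod k"
          using that(2) by (metis mod_add_cong mod_mod_trivial)
        ultimately show ?thesis
          by (simp add: nonzero_pos_def)
      qed
      consider "m = 1" | "m = 2" | "3 \<le> m"
        using less.prems by linarith
      then show False
      proof cases
        case 1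
        then show False
          using nonzero_shift1[OF r] nz[of _ b] by auto
      next
        case 2
        then show False
          using nonzero_shift2[OF r] nz[of _ "2 * b"] by auto
      next
        case 3
        \<comment> \<open>Coprimality of \<open>k\<close> and \<open>b\<close> excludes shift 0,
          under which the pattern of nonzero letters would match.\<close>
        have "\<not> k dvd m * b"
          using False coprime by (simp add: coprime_dvd_mult_left_iff)
        then have "0 < m * b mod k"
          by (simp add: mod_greater_zero_iff_not_dvd)
        moreover have "m * b mod k < k"
          using k_pos by simp
        moreover have "3 * c \<le> m * c"
          using 3 by simp
        ultimately show False
          using nonzero_shift3[OF r] nz[of _ "m * b mod k"] by (meson mod_mod_trivial order_less_le_trans)
      qed
    qed
  qed
qed

section \<open>Minimality\<close>

text \<open>The letter \<open>d\<close> is arbitrary because the induction passes from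
  \<open>d\<close> at position \<open>n\<close> to \<open>d - 1\<close> at the earlier position
  \<open>q\<close>. The power ends exactly at \<open>n\<close>, so it involves no later
  letter.\<close>

lemma decreased_repeats:
  assumes "d < x n"
  shows "\<exists>m>0. \<exists>i. i + m * (b + c) = n + 1 \<and> repeats (m * b) (m * c) (x(n := d)) i"
  using assms
proof (induction n arbitrary: d rule: less_induct)
  case (less n)
  define q r where "q = n div k" and "r = n mod k"
  have n: "n = k * q + r" and "r < k"
    using k_pos by (simp_all add: q_def r_def)
  have xn: "x n = (if r = b + c - 1 then 1 else if r = k - 1 then x q + 1 else 0)"
    using x_block[OF \<open>r < k\<close>] n by simp
  consider (one) "r = b + c - 1" "d = 0" | (zero) "r = k - 1" "d = 0"
    | (pos) "r = k - 1" "d > 0" "d - 1 < x q"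
    using less.prems xn by (cases "d = 0") (auto split: if_splits)
  note cases = this
  \<comment> \<open>The premises admit a nonzero position \<open>s\<close> of the block only if it
    is \<open>r\<close>, that is \<open>n\<close> itself, where the letter has become 0.\<close>
  have zeros: "(x(n := 0)) (k * q + s) = 0"
    if "s < k" "s = b + c - 1 \<Longrightarrow> r = b + c - 1" "s = k - 1 \<Longrightarrow> r = k - 1" for s
  proof (cases "s = r")
    case True
    then show ?thesis
      by (simp add: n)
  next
    case False
    then have "x (k * q + s) = 0"
      using that x_block[OF that(1), of q] by auto
    then show ?thesis
      by simp
  qed
  note bounds = c_less c_pos k_eq
  from cases show ?case
  proof cases
    case one
    have "repeats b c (x(n := d)) (k * q)"
      unfolding repeats_def
    proof (intro allI impI)
      fix j assume "j < c"
      then have "(x(n := 0)) (k * q + j) = 0" "(x(n := 0)) (k * q + (j + b)) = 0"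
        by (rule_tac zeros; use bounds one in linarith)+
      then show "(x(n := d)) (k * q + j) = (x(n := d)) (k * q + j + b)"
        by (simp add: one add.assoc)
    qed
    moreover have "k * q + 1 * (b + c) = n + 1"
      using one n c_pos by simp
    ultimately have "\<exists>i. i + 1 * (b + c) = n + 1 \<and> repeats (1 * b) (1 * c) (x(n := d)) i"
      unfolding mult_1 by blast
    then show ?thesis
      using zero_less_one by blast
  next
    case zero
    \<comment> \<open>Starting at offset \<open>c\<close> gives a factor of length
      \<open>b + c\<close> ending at \<open>n\<close>; the letter 1 lies between the two windows
      compared.\<close>
    have "repeats b c (x(n := d)) (k * q + c)"
      unfolding repeats_def
    proof (intro allI impI)
      fix j assume "j < c"
      then have "(x(n := 0)) (k * q + (c + j)) = 0" "(x(n := 0)) (k * q + (c + j + b)) = 0"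
        by (rule_tac zeros; use bounds zero in linarith)+
      then show "(x(n := d)) (k * q + c + j) = (x(n := d)) (k * q + c + j + b)"
        by (simp add: zero add.assoc)
    qed
    moreover have "k * q + c + 1 * (b + c) = n + 1"
      using zero n c_pos k_eq by simp
    ultimately have "\<exists>i. i + 1 * (b + c) = n + 1 \<and> repeats (1 * b) (1 * c) (x(n := d)) i"
      unfolding mult_1 by blast
    then show ?thesis
      using zero_less_one by blast
  next
    case pos
    have "q < n"
    proof -
      have "q \<le> k * q" "0 < r"
        using pos(1) c_less c_pos k_eq by auto
      then show ?thesis
        using n by linarith
    qed
    from less.IH[OF this pos(3)] obtain m i where m: "m > 0" "i + m * (b + c) = q + 1"
      and rep: "repeats (m * b) (m * c) (x(q := d - 1)) i"
      by blast
    \<comment> \<open>The word \<open>x(n := d)\<close> is the image of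
      \<open>x(q := d - 1)\<close>: block \<open>q\<close> ends at \<open>n\<close>, with the letter
      \<open>(d - 1) + 1 = d\<close>.\<close>
    have decreased_block: "(x(n := d)) (k * t + s) = 
        (if s = b + c - 1 then 1 else if s = k - 1 then (x(q := d - 1)) t + 1 else 0)"
      if "s < k" for s t
    proof (cases "k * t + s = n")
      case True
      then have "t = q" "s = r"
        using that k_pos by (auto simp: q_def r_def)
      moreover have "k - 1 \<noteq> b + c - 1"
        using c_pos k_eq by simp
      ultimately show ?thesis
        using True pos by simp
    next
      case False
      then have "s \<noteq> k - 1 \<or> t \<noteq> q"
        using n pos(1) by auto
      then show ?thesis
        using False x_block[OF that, of t] by auto
    qed
    have "repeats (k * m * b) (k * m * c) (x(n := d)) (k * i)"
      unfolding repeats_def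
    proof (intro allI impI)
      fix j assume j: "j < k * m * c"
      define t s where "t = j div k" and "s = j mod k"
      have j_eq: "j = k * t + s" and "s < k"
        using k_pos by (simp_all add: t_def s_def)
      have "t < m * c"
        using j by (simp add: t_def less_mult_imp_div_less mult.commute mult.left_commute)
      then have eq: "(x(q := d - 1)) (i + t) = (x(q := d - 1)) (i + t + m * b)"
        using rep by (simp add: repeats_def)
      have "k * i + j = k * (i + t) + s" "k * i + j + k * m * b = k * (i + t + m * b) + s"
        by (simp_all add: j_eq algebra_simps)
      then show "(x(n := d)) (k * i + j) = (x(n := d)) (k * i + j + k * m * b)"
        using eq by (simp only: decreased_block[OF \<open>s < k\<close>])
    qed
    \<comment> \<open>The image of a power ending at \<open>q\<close> ends with block
      \<open>q\<close>, hence at \<open>n\<close>.\<close>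
    moreover have "k * i + k * m * (b + c) = n + 1"
    proof -
      have "k * i + k * m * (b + c) = k * (q + 1)"
        unfolding m(2)[symmetric] by (simp add: mult.assoc distrib_left)
      then show ?thesis
        using n pos(1) k_pos by simp
    qed
    moreover have "k * m > 0"
      using m(1) k_pos by simp
    ultimately show ?thesis
      by blast
  qed
qed

lemma lex_least: "lex_least_free (b + c) b x"
  unfolding lex_least_free_def
proof (intro conjI allI impI)
  show "frac_power_free (b + c) b x"
    using not_repeats by (simp add: frac_power_free_iff[OF c_less])
next
  fix y :: "nat \<Rightarrow> nat"
  assume y: "frac_power_free (b + c) b y"
  show "x = y \<or> less_fun x y"
  proof (cases "x = y")
    case False
    then have ex: "\<exists>n. x n \<noteq> y n"
      by auto
    define n where "n = (LEAST n. x n \<noteq> y n)"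
    have neq: "x n \<noteq> y n"
      unfolding n_def using ex by (rule LeastI_ex)
    have eq: "x l = y l" if "l < n" for l
      using that not_less_Least unfolding n_def by blast
    have "\<not> y n < x n"
    proof
      assume "y n < x n"
      from decreased_repeats[OF this] obtain m i where m: "m > 0" "i + m * (b + c) = n + 1"
        and rep: "repeats (m * b) (m * c) (x(n := y n)) i"
        by blast
      \<comment> \<open>The power ends at \<open>n\<close>, and up to there \<open>y\<close> agrees
        with the altered word.\<close>
      have "(x(n := y n)) l = y l" if "l \<le> n" for l
        using eq[of l] that by auto
      moreover have "i + j + m * b \<le> n" "i + j \<le> n" if "j < m * c" for j
        using m(2) that by (simp_all add: distrib_left)
      ultimately have "repeats (m * b) (m * c) y i"
        using rep unfolding repeats_def by metis
      then show False
        using y m(1) by (simp add: frac_power_free_iff[OF c_less])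
    qed
    then have "x n < y n"
      using neq by simp
    then show ?thesis
      using eq unfolding less_fun_def by blast
  qed simp
qed

section \<open>Regularity\<close>

text \<open>The lowest base-\<open>k\<close> digit of \<open>j\<close> selects a place in the block.
  The last place leads to the sequence for \<open>j div k\<close> plus 1; every other place gives a
  constant.\<close>

lemma kernel_cases:
  "(\<exists>t. \<forall>i. x (k ^ e * i + j) = t) \<or> (\<exists>t. \<forall>i. x (k ^ e * i + j) = x i + t)" if "j < k ^ e"
  using that
proof (induction e arbitrary: j)
  case (Suc e)
  have "j div k < k ^ e"
    using Suc.prems by (simp add: less_mult_imp_div_less mult.commute)
  have split: "k ^ Suc e * i + j = k * (k ^ e * i + j div k) + j mod k" for i
    by (simp add: algebra_simps)
  have step: "x (k ^ Suc e * i + j) = (if j mod k = b + c - 1 then 1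
      else if j mod k = k - 1 then x (k ^ e * i + j div k) + 1 else 0)" for i
    unfolding split by (rule x_block) (use k_pos in simp)
  consider "\<exists>t. \<forall>i. x (k ^ Suc e * i + j) = t"
    | "\<forall>i. x (k ^ Suc e * i + j) = x (k ^ e * i + j div k) + 1"
    unfolding step by (cases "j mod k = b + c - 1"; cases "j mod k = k - 1") simp_all
  then show ?case
  proof cases
    case 1
    then show ?thesis ..
  next
    case 2
    then show ?thesis
      using Suc.IH[OF \<open>j div k < k ^ e\<close>] by (metis add.assoc)
  qed
qed auto

lemma regular: "regular k (\<lambda>i. int (x i))"
proof -
  let ?s = "\<lambda>i. int (x i)" and ?one = "\<lambda>_ :: nat. 1 :: int"
  have const: "(\<lambda>_. t) \<in> int_seq.span {?s, ?one}" for t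
  proof -
    have "int_scale t ?one \<in> int_seq.span {?s, ?one}"
      by (intro int_seq.span_scale int_seq.span_base) simp
    then show ?thesis
      by (simp add: int_scale_def)
  qed
  have shift: "(\<lambda>i. ?s i + t) \<in> int_seq.span {?s, ?one}" for t
  proof -
    have "?s + (\<lambda>_. t) \<in> int_seq.span {?s, ?one}"
      by (intro int_seq.span_add const int_seq.span_base) simp
    then show ?thesis
      by (simp add: plus_fun_def)
  qed
  have "kernel k ?s \<subseteq> int_seq.span {?s, ?one}"
  proof
    fix f assume "f \<in> kernel k ?s"
    then obtain e j where f: "f = (\<lambda>i. ?s (k ^ e * i + j))" and "j \<le> k ^ e - 1"
      by (auto simp: kernel_def)
    then have "j < k ^ e"
      using k_pos by (metis Suc_pred' less_Suc_eq_le zero_less_power)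
    from kernel_cases[OF this] show "f \<in> int_seq.span {?s, ?one}"
    proof (elim disjE exE)
      fix t assume "\<forall>i. x (k ^ e * i + j) = t"
      then have "f = (\<lambda>_. int t)"
        by (simp add: f)
      then show ?thesis
        by (simp only: const)
    next
      fix t assume "\<forall>i. x (k ^ e * i + j) = x i + t"
      then have "f = (\<lambda>i. ?s i + int t)"
        by (simp add: f)
      then show ?thesis
        by (simp only: shift)
    qed
  qed
  \<comment> \<open>Regularity asks for equal spans, so the generators must come from the kernel
    too: the constant 1 is read off at place \<open>b + c - 1\<close> of every block.\<close>
  moreover have "{?s, ?one} \<subseteq> kernel k ?s"
  proof -
    have "?s \<in> kernel k ?s"
      unfolding kernel_def by (intro CollectI exI[of _ 0]) simp
    moreover have "?one = (\<lambda>i. ?s (k ^ 1 * i + (b + c - 1)))" "b + c - 1 \<le> k ^ 1 - 1"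
      using x_block[of "b + c - 1"] k_eq c_pos by simp_all
    then have "?one \<in> kernel k ?s"
      unfolding kernel_def by (intro CollectI exI[of _ 1] exI[of _ "b + c - 1"] conjI)
    ultimately show ?thesis
      by simp
  qed
  then have "{?s, ?one} \<subseteq> int_seq.span (kernel k ?s)"
    using int_seq.span_superset by blast
  ultimately have "int_seq.span {?s, ?one} = int_seq.span (kernel k ?s)"
    unfolding int_seq.span_eq by (intro conjI)
  moreover have "finite {?s, ?one}"
    by simp
  ultimately show ?thesis
    unfolding regular_def by (intro exI[of _ "{?s, ?one}"] conjI)
qed

end

section \<open>From the morphism to the block description\<close>

theorem theorem3p3:
  fixes a b :: nat and \<phi> :: "nat \<Rightarrow> nat list"
  assumes "0 < a" and "0 < b" and "coprime a b"
    and "5 / 3 \<le> real a / real b" and "real a / real b < 2"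
    and "gcd b 2 = 1"
    and "\<And>n. \<phi> n = replicate (a - 1) 0 @ [1] @ replicate (a - b - 1) 0 @ [n + 1]"
  shows "uniform_morphism (2 * a - b) \<phi>
    \<and> least_free_word a b = fixed_point \<phi> 0
    \<and> 2 * a - b \<in> rho a b"
proof -
  define c where "c = a - b"
  have "5 * real b \<le> 3 * real a" "real a < 2 * real b"
    using assms(2,4,5) by (simp_all add: field_simps)
  then have "5 * b \<le> 3 * a" "a < 2 * b"
    by linarith+
  then have a: "a = b + c" and c: "c < b" "2 * b \<le> 3 * c" and k: "2 * a - b = b + 2 * c"
    by (simp_all add: c_def)
  have "0 < c"
    using c assms(2) by simp
  \<comment> \<open>Oddness of \<open>b\<close> allows the factor 2; subtracting \<open>b\<close>
    then gives the block width.\<close>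
  have "coprime (2 * a) b"
    using assms(3,6) by (metis coprime_iff_gcd_eq_1 coprime_commute coprime_mult_left_iff)
  moreover have "2 * a = b + 2 * c + b"
    using a k by simp
  ultimately have coprime: "coprime (b + 2 * c) b"
    by (simp only: coprime_iff_gcd_eq_1 gcd_add1)
  have phi: "\<phi> n = replicate (b + c - 1) 0 @ [1] @ replicate (c - 1) 0 @ [n + 1]" for n
    using assms(7)[of n] a by simp
  have unif: "uniform_morphism (b + 2 * c) \<phi>"
    unfolding uniform_morphism_def phi using \<open>0 < c\<close> k by simp
  have "b + c - 1 \<noteq> 0"
    using c \<open>0 < c\<close> by simp
  then have "hd (\<phi> 0) = 0"
    unfolding phi by (cases "b + c - 1") auto
  moreover have "2 \<le> b + 2 * c"
    using \<open>0 < c\<close> by simp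
  ultimately have "fixed_by \<phi> (fixed_point \<phi> 0)"
    unfolding fixed_point_def using theI'[OF ex1_fixed_point[OF unif]] by blast
  define x where "x = fixed_point \<phi> 0"
  have block: "x ((b + 2 * c) * q + r) =
      (if r = b + c - 1 then 1 else if r = b + 2 * c - 1 then x q + 1 else 0)"
    if "r < b + 2 * c" for q r
  proof -
    have "x ((b + 2 * c) * q + r) = \<phi> (x q) ! r"
      using fixed_by_block[OF unif \<open>fixed_by \<phi> (fixed_point \<phi> 0)\<close>, of q] that
      by (simp add: x_def)
    then show ?thesis
      using that \<open>0 < c\<close> unfolding phi by (auto simp: nth_append nth_Cons')
  qed
  interpret block_word b c x
    by unfold_locales (use c coprime block in auto)
  have "least_free_word a b = x"
    unfolding least_free_word_def
    using ex1_lex_least_free[of b a] lex_least a assms(2) \<open>0 < c\<close> by (intro the1_equality) auto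
  moreover have "b + 2 * c \<in> rho a b"
    using \<open>2 \<le> b + 2 * c\<close> regular[unfolded k_eq] calculation by (simp add: rho_def)
  ultimately show ?thesis
    using unif by (simp add: x_def k)
qed

end
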